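(* Let $0<\Lambda_1\le\Lambda_2<\infty$, $n^\ast:=\frac{\Lambda_1}{\Lambda_2}(n-1)+1$, $\gamma\ge0$ and $0<q<n^\ast-2$. Let $R>0$, let $\Omega$ be a region (domain) in $\mathbb B_R^c(0)=\mathbb R^n\setminus\mathbb B_R(0)$, and let $c\in L^\infty(\Omega)$ satisfy $$c(x)\le\frac{-q\big(\Lambda_2(q+1)-\Lambda_1(n-1)\big)}{|x|^2}-\frac{\gamma q}{|x|}\quad\text{for }|x|>R.$$ Let $u\in C(\overline\Omega)$ be a viscosity solution of $$\mathcal M^-_{\Lambda_1,\Lambda_2}(D^2u)-\gamma|Du|+c(x)u\le0\ \text{ in }\Omega,\qquad u\ge0\ \text{ on }\partial\Omega,$$ such that $$\liminf_{|x|\to\infty}u(x)|x|^q\ge0 .$$ Then $u(x)\ge0$ for all $x\in\Omega$.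
   Context: $\mathbb B_R(0)$ is the ball of radius $R$ centered at the origin. For a real symmetric $n\times n$ matrix $M$ with eigenvalues $e_1,\dots,e_n$, $\mathcal M^-_{\Lambda_1,\Lambda_2}(M)=\Lambda_1\sum_{e_i>0}e_i+\Lambda_2\sum_{e_i<0}e_i$ (Pucci extremal operator). A continuous function $u$ is a viscosity solution of the inequality $\mathcal M^-_{\Lambda_1,\Lambda_2}(D^2u)-\gamma|Du|+c(x)u\le0$ in $\Omega$ if, whenever $x_0\in\Omega$, $\phi\in C^2(\Omega)$ and $u-\phi$ has a local minimum at $x_0$, one has $\mathcal M^-_{\Lambda_1,\Lambda_2}(D^2\phi(x_0))-\gamma|D\phi(x_0)|+c(x_0)u(x_0)\le0$. The function $c$ is a bounded function defined pointwise on $\Omega$. The limit inferior is taken over $x\in\Omega$ (and the condition is void if $\Omega$ is bounded). *)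

theory Defs
  imports "HOL-Analysis.Analysis" "HOL-Computational_Algebra.Computational_Algebra"
begin

definition charpoly :: "real^'n^'n \<Rightarrow> real poly" where
  "charpoly M = det (mat [:0, 1:] - map_matrix (\<lambda>a. [:a:]) M)"

text \<open>The real eigenvalues, repeated according to algebraic multiplicity. A symmetric matrix
  has \<open>CARD('n)\<close> of them; for other matrices the non-real eigenvalues are missing.\<close>

definition eigenvalues :: "real^'n^'n \<Rightarrow> real multiset" where
  "eigenvalues M = proots (charpoly M)"

definition pucci_minus :: "real \<Rightarrow> real \<Rightarrow> real^'n^'n \<Rightarrow> real" where
  "pucci_minus \<Lambda>1 \<Lambda>2 M =
     \<Lambda>1 * (\<Sum>e\<in>#filter_mset (\<lambda>e. e > 0) (eigenvalues M). e) +
     \<Lambda>2 * (\<Sum>e\<in>#filter_mset (\<lambda>e. e < 0) (eigenvalues M). e)"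

definition gradient :: "(real^'n \<Rightarrow> real) \<Rightarrow> real^'n \<Rightarrow> real^'n" where
  "gradient \<phi> x = (THE D. GDERIV \<phi> x :> D)"

definition hessian :: "(real^'n \<Rightarrow> real) \<Rightarrow> real^'n \<Rightarrow> real^'n^'n" where
  "hessian \<phi> x = jacobian (gradient \<phi>) (at x)"

text \<open>Membership in \<open>C\<^sup>2(\<Omega>)\<close>, meant for open \<open>\<Omega>\<close>; continuity of \<open>\<phi>\<close> and of its gradient
  follows from differentiability.\<close>

definition C2_on :: "(real^'n) set \<Rightarrow> (real^'n \<Rightarrow> real) \<Rightarrow> bool" where
  "C2_on \<Omega> \<phi> \<longleftrightarrow>
     (\<forall>x\<in>\<Omega>. \<phi> differentiable (at x)) \<and>
     (\<forall>x\<in>\<Omega>. gradient \<phi> differentiable (at x)) \<and>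
     continuous_on \<Omega> (hessian \<phi>)"

definition local_min_on :: "(real^'n) set \<Rightarrow> (real^'n \<Rightarrow> real) \<Rightarrow> real^'n \<Rightarrow> bool" where
  "local_min_on \<Omega> f x0 \<longleftrightarrow>
     x0 \<in> \<Omega> \<and> (\<exists>r>0. \<forall>x\<in>\<Omega> \<inter> ball x0 r. f x0 \<le> f x)"

text \<open>Viscosity solutions of \<open>M\<^sup>-(D\<^sup>2u) - \<gamma>|Du| + c(x)u \<le> 0\<close> in \<open>\<Omega>\<close>.\<close>

definition viscosity_supersolution ::
  "real \<Rightarrow> real \<Rightarrow> real \<Rightarrow> (real^'n \<Rightarrow> real) \<Rightarrow> (real^'n) set \<Rightarrow> (real^'n \<Rightarrow> real) \<Rightarrow> bool" where
  "viscosity_supersolution \<Lambda>1 \<Lambda>2 \<gamma> c \<Omega> u \<longleftrightarrow>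
     continuous_on \<Omega> u \<and>
     (\<forall>x0 \<phi>. x0 \<in> \<Omega> \<and> C2_on \<Omega> \<phi> \<and> local_min_on \<Omega> (\<lambda>x. u x - \<phi> x) x0 \<longrightarrow>
        pucci_minus \<Lambda>1 \<Lambda>2 (hessian \<phi> x0) - \<gamma> * norm (gradient \<phi> x0) + c x0 * u x0 \<le> 0)"

definition n_star :: "real \<Rightarrow> real \<Rightarrow> nat \<Rightarrow> real" where
  "n_star \<Lambda>1 \<Lambda>2 n = \<Lambda>1 / \<Lambda>2 * (real n - 1) + 1"

end

theory Submission
  imports Defs
begin

text \<open>
  Write \<open>r = norm x\<close>, \<open>A = \<Lambda>1 * (n - 1)\<close>, and let \<open>c0\<close> be the upper bound imposed on \<open>c\<close>.
  The power \<open>v = r powr - q\<close> is decreasing and convex in \<open>r\<close>, so \<open>- v\<close> has one nonpositive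
  radial eigenvalue and \<open>n - 1\<close> positive tangential ones, and \<open>c0\<close> is exactly the potential for which
  \<open>M\<^sup>-(D\<^sup>2(- v)) - \<gamma> * |D(- v)| + c0 * (- v) = 0\<close>. If \<open>u\<close> is negative somewhere, then, by the
  boundary values and the condition at infinity, \<open>u / v\<close> attains a negative minimum \<open>m\<close>
  inside \<open>\<Omega>\<close>, so \<open>m * v\<close> touches \<open>u\<close> from below there. This alone is no contradiction: it only
  gives equality in the viscosity inequality.

  To gain strictness, \<open>v\<close> is replaced by \<open>\<psi> = v - \<epsilon> * r powr s\<close>. On a ball of radius
  \<open>\<rho>\<close> the perturbation enters the operator with a definite sign once \<open>s\<close> is large in terms of \<open>\<rho>\<close>,
  because its second order part grows like \<open>s\<^sup>2\<close> and its first order part only like \<open>s\<close>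
  (\<open>barrier_strict_inequality\<close>). Since \<open>\<psi>\<close> is of no use near infinity, the
  minimum of \<open>u / \<psi>\<close> is taken over a sublevel set of \<open>u / v\<close> at a negative level only, which is a
  compact subset of \<open>\<Omega>\<close> (\<open>compact_negative_sublevel\<close>). If \<open>\<epsilon>\<close> is small, \<open>\<psi> / v\<close> is so close to \<open>1\<close>
  there that the minimum cannot sit on the edge of the sublevel set, so it is a local minimum
  in \<open>\<Omega>\<close>, and the strict inequality contradicts the viscosity inequality.

  The operator is defined through the roots of the characteristic polynomial, so
  the Hessian of a radial function, a multiple of the identity plus a multiple of
  \<open>x\<^sub>i * x\<^sub>j\<close>, is diagonalised by an orthogonal matrix that maps a basis vector to
  \<open>x / r\<close> (\<open>eigenvalues_scalar_plus_rank_one\<close>).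
\<close>

\<comment> \<open>The same sign denotes the components of vectors; here it is used for those only.\<close>
no_notation fps_nth (infixl \<open>$\<close> 75)

section \<open>Eigenvalues of a scalar matrix plus a rank one matrix\<close>

text \<open>
  Over the polynomial ring, \<open>X * I - P M Q = P (X * I - M) Q\<close>, since \<open>X * I\<close> commutes with
  everything; the determinants of \<open>P\<close> and \<open>Q\<close> multiply to \<open>1\<close>.
\<close>
lemma charpoly_conjugate:
  fixes P Q M :: "real^'n^'n"
  assumes "P ** Q = mat 1"
  shows "charpoly (P ** M ** Q) = charpoly M"
proof -
  define C :: "real^'n^'n \<Rightarrow> real poly^'n^'n" where "C = map_matrix (\<lambda>a. [:a:])"
  define X :: "real poly^'n^'n" where "X = mat [:0, 1:]"
  have const_sum: "[:sum f A:] = (\<Sum>k\<in>A. [:f k:])" for f :: "'n \<Rightarrow> real" and A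
  proof (induction A rule: infinite_finite_induct)
    case (insert k A)
    then show ?case by (simp flip: insert.IH)
  qed auto
  have C_mult: "C (A ** B) = C A ** C B" for A B
    by (simp add: C_def vec_eq_iff matrix_matrix_mult_def const_sum mult.commute)
  have C_1: "C (mat 1) = mat 1"
    by (simp add: C_def vec_eq_iff mat_def)
  have X_eq: "X = C P ** X ** C Q"
  proof -
    have "X ** C Q = C Q ** X"
      by (simp add: X_def mat_def matrix_matrix_mult_def vec_eq_iff if_distrib if_distribR
          mult.commute cong: if_cong)
    then have "C P ** X ** C Q = C (P ** Q) ** X"
      by (simp add: C_mult flip: matrix_mul_assoc)
    then show ?thesis by (simp add: assms C_1)
  qed
  have diff: "A ** (B - D) ** E = A ** B ** E - A ** D ** E" for A B D E :: "real poly^'n^'n"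
    by (simp add: vec_eq_iff matrix_matrix_mult_def sum_subtractf algebra_simps)
  have "charpoly (P ** M ** Q) = det (X - C (P ** M ** Q))"
    by (simp add: charpoly_def X_def C_def)
  also have "X - C (P ** M ** Q) = C P ** (X - C M) ** C Q"
    by (subst X_eq) (simp add: C_mult diff)
  also have "det \<dots> = det (C (P ** Q)) * det (X - C M)"
    by (simp add: det_mul C_mult algebra_simps)
  also have "\<dots> = det (X - C M)"
    by (simp add: assms C_1)
  also have "\<dots> = charpoly M"
    by (simp add: charpoly_def X_def C_def)
  finally show ?thesis .
qed

lemma eigenvalues_diagonal:
  fixes D :: "real^'n^'n"
  assumes "\<And>i j. i \<noteq> j \<Longrightarrow> D$i$j = 0"
  shows "eigenvalues D = (\<Sum>i\<in>UNIV. {#D$i$i#})"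
proof -
  have "charpoly D = (\<Prod>i\<in>UNIV. [:- D$i$i, 1:])"
    unfolding charpoly_def
    by (subst det_diagonal) (auto simp: mat_def assms)
  then show ?thesis
    by (simp add: eigenvalues_def proots_prod)
qed

text \<open>
  In an orthonormal basis containing the direction of \<open>x\<close> the matrix is diagonal: the
  rank one part contributes \<open>b * (norm x)\<^sup>2\<close> along \<open>x\<close> and nothing across.
\<close>
lemma eigenvalues_scalar_plus_rank_one:
  fixes x :: "real^'n"
  shows "eigenvalues (mat a + b *\<^sub>R (\<chi> i j. x$i * x$j)) =
           add_mset (a + b * (norm x)\<^sup>2) (replicate_mset (CARD('n) - 1) a)"
proof -
  \<comment> \<open>Any coordinate will do as the one to be mapped to the direction of \<open>x\<close>.\<close>
  obtain k :: 'n where True by simp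
  obtain e :: "real^'n" where e: "norm e = 1" "x = norm x *\<^sub>R e"
  proof (cases "x = 0")
    case True
    then show ?thesis using that[of "axis k 1"] by simp
  next
    case False
    then show ?thesis using that[of "x /\<^sub>R norm x"] by simp
  qed
  obtain P where P: "orthogonal_matrix P" "P *v axis k 1 = e"
    using orthogonal_matrix_exists_basis e(1) by blast
  define D :: "real^'n^'n" where
    "D = (\<chi> i j. if i = j then if i = k then a + b * (norm x)\<^sup>2 else a else 0)"
  have PPt: "P ** transpose P = mat 1"
    using P(1) by (simp add: orthogonal_matrix_def)
  have PPt_nth: "(\<Sum>l\<in>UNIV. P$i$l * P$j$l) = (if i = j then 1 else 0)" for i j
    using arg_cong[OF PPt, of "\<lambda>M. M$i$j"]
    by (simp add: matrix_matrix_mult_def transpose_def mat_def)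
  have col: "P$i$k * norm x = x$i" for i
  proof -
    have "e$i = P$i$k"
      by (simp add: P(2)[symmetric] matrix_vector_mul_component inner_axis)
    then show ?thesis
      by (metis e(2) vector_scaleR_component real_scaleR_def mult.commute)
  qed
  have "(P ** D ** transpose P)$i$j = (mat a + b *\<^sub>R (\<chi> i j. x$i * x$j))$i$j" for i j
  proof -
    have "(P ** D ** transpose P)$i$j = (\<Sum>l\<in>UNIV. P$i$l * D$l$l * P$j$l)"
      by (simp add: matrix_matrix_mult_def transpose_def D_def if_distrib[of "\<lambda>y. _ * y"] cong: if_cong)
    also have "\<dots> = (\<Sum>l\<in>UNIV. a * (P$i$l * P$j$l) +
        (if l = k then b * (norm x)\<^sup>2 * (P$i$k * P$j$k) else 0))"
      by (intro sum.cong) (auto simp: D_def algebra_simps)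
    also have "\<dots> = a * (\<Sum>l\<in>UNIV. P$i$l * P$j$l) + b * ((P$i$k * norm x) * (P$j$k * norm x))"
      by (simp add: sum.distrib sum_distrib_left power2_eq_square)
    finally show ?thesis
      by (simp add: PPt_nth col mat_def)
  qed
  then have "P ** D ** transpose P = mat a + b *\<^sub>R (\<chi> i j. x$i * x$j)"
    by (simp add: vec_eq_iff)
  then have "eigenvalues (mat a + b *\<^sub>R (\<chi> i j. x$i * x$j)) = eigenvalues D"
    using charpoly_conjugate[OF PPt, of D] by (simp add: eigenvalues_def)
  also have "\<dots> = (\<Sum>i\<in>UNIV. {#D$i$i#})"
    by (rule eigenvalues_diagonal) (simp add: D_def)
  also have "\<dots> = {#D$k$k#} + (\<Sum>i\<in>UNIV - {k}. {#D$i$i#})"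
    by (rule sum.remove) auto
  also have "(\<Sum>i\<in>UNIV - {k}. {#D$i$i#}) = (\<Sum>i\<in>UNIV - {k}. {#a#})"
    by (intro sum.cong) (auto simp: D_def)
  also have "\<dots> = replicate_mset (CARD('n) - 1) a"
  proof -
    have "(\<Sum>i\<in>A. {#a#}) = replicate_mset (card A) a" if "finite A" for A :: "'n set"
      using that by induction auto
    then show ?thesis by (simp add: card_Diff_singleton)
  qed
  finally show ?thesis
    by (simp add: D_def)
qed

text \<open>The sign pattern of the negative of a decreasing convex radial function: the \<open>n - 1\<close> equal
  eigenvalues are positive and get the weight \<open>\<Lambda>1\<close>, the single one gets \<open>\<Lambda>2\<close>.\<close>
lemma pucci_minus_scalar_plus_rank_one:
  fixes x :: "real^'n"
  assumes "0 < a" "a + b * (norm x)\<^sup>2 \<le> 0"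
  shows "pucci_minus \<Lambda>1 \<Lambda>2 (mat a + b *\<^sub>R (\<chi> i j. x$i * x$j)) =
           \<Lambda>1 * (real CARD('n) - 1) * a + \<Lambda>2 * (a + b * (norm x)\<^sup>2)"
proof -
  have f: "filter_mset Q (replicate_mset n a) = (if Q a then replicate_mset n a else {#})" for Q n
    by (induction n) auto
  have "(a + b * (norm x)\<^sup>2) * \<Lambda>2 = 0" if "\<not> a + b * (norm x)\<^sup>2 < 0"
    using that assms by simp
  then show ?thesis
    using assms
    by (auto simp: pucci_minus_def eigenvalues_scalar_plus_rank_one f of_nat_diff Suc_le_eq)
qed

section \<open>Radial functions\<close>

lemma gradient_eqI:
  assumes "GDERIV f x :> D"
  shows "gradient f x = D"
  unfolding gradient_def
proof (rule the_equality)
  show "GDERIV f x :> D" by fact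
  fix E assume "GDERIV f x :> E"
  then have "(\<lambda>h. inner h E) = (\<lambda>h. inner h D)"
    using assms unfolding gderiv_def by (rule has_derivative_unique)
  then show "E = D" by (metis inner_commute vector_eq_rdot)
qed

lemma GDERIV_radial:
  fixes x :: "'a::real_inner"
  assumes "(f has_real_derivative f') (at (norm x))" "x \<noteq> 0"
  shows "GDERIV (\<lambda>x. f (norm x)) x :> (f' / norm x) *\<^sub>R x"
  using GDERIV_DERIV_compose[OF GDERIV_norm[OF assms(2)] assms(1)] assms(2)
  by (simp add: sgn_div_norm divide_inverse mult.commute)

lemma gradient_radial:
  fixes x :: "real^'n"
  assumes "\<And>r. 0 < r \<Longrightarrow> (f has_real_derivative f1 r) (at r)" "x \<noteq> 0"
  shows "gradient (\<lambda>x. f (norm x)) x = (f1 (norm x) / norm x) *\<^sub>R x"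
  by (intro gradient_eqI GDERIV_radial assms) (simp add: assms)

text \<open>The Hessian at \<open>x\<close> of a radial function whose profile has the first and second derivatives
  \<open>f1\<close> and \<open>f2\<close>. Its eigenvalue in the direction of \<open>x\<close> is \<open>f2 (norm x)\<close>, all others are
  \<open>f1 (norm x) / norm x\<close>.\<close>
definition radial_hessian :: "(real \<Rightarrow> real) \<Rightarrow> (real \<Rightarrow> real) \<Rightarrow> real^'n \<Rightarrow> real^'n^'n" where
  "radial_hessian f1 f2 x = mat (f1 (norm x) / norm x) +
     ((f2 (norm x) - f1 (norm x) / norm x) / (norm x)\<^sup>2) *\<^sub>R (\<chi> i j. x$i * x$j)"

lemma gradient_radial_has_derivative:
  fixes x :: "real^'n"
  assumes f: "\<And>r. 0 < r \<Longrightarrow> (f has_real_derivative f1 r) (at r)"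
    and f1: "\<And>r. 0 < r \<Longrightarrow> (f1 has_real_derivative f2 r) (at r)"
    and x: "x \<noteq> 0"
  shows "(gradient (\<lambda>x. f (norm x)) has_derivative (\<lambda>h. radial_hessian f1 f2 x *v h)) (at x)"
proof (rule has_derivative_transform_within_open[of _ _ _ _ "- {0}"])
  define k where "k = (f2 (norm x) - f1 (norm x) / norm x) / norm x"
  have r: "norm x > 0" using x by simp
  have "((\<lambda>r. f1 r / r) has_real_derivative k) (at (norm x))"
    unfolding k_def using r
    by (auto intro!: derivative_eq_intros f1[OF r] simp: field_simps power2_eq_square)
  from GDERIV_radial[OF this x]
  have "((\<lambda>x. f1 (norm x) / norm x) has_derivative (\<lambda>h. inner h ((k / norm x) *\<^sub>R x))) (at x)"
    by (simp add: gderiv_def)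
  then have "((\<lambda>x. (f1 (norm x) / norm x) *\<^sub>R x) has_derivative
      (\<lambda>h. (f1 (norm x) / norm x) *\<^sub>R h + inner h ((k / norm x) *\<^sub>R x) *\<^sub>R x)) (at x)"
    by (intro has_derivative_scaleR) (auto intro!: has_derivative_ident)
  moreover have "(f1 (norm x) / norm x) *\<^sub>R h + inner h ((k / norm x) *\<^sub>R x) *\<^sub>R x =
      radial_hessian f1 f2 x *v h" for h
  proof -
    have "(mat a :: real^'n^'n) *v h = a *\<^sub>R h" for a
      by (simp add: vec_eq_iff matrix_vector_mult_def mat_def if_distrib if_distribR cong: if_cong)
    moreover have "(\<chi> i j. x$i * x$j) *v h = inner h x *\<^sub>R x"
      by (simp add: vec_eq_iff matrix_vector_mult_def inner_vec_def sum_distrib_left mult_ac)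
    ultimately show ?thesis
      by (simp add: radial_hessian_def k_def matrix_vector_mult_add_rdistrib
          scaleR_matrix_vector_assoc[symmetric] power2_eq_square)
  qed
  ultimately show "((\<lambda>x. (f1 (norm x) / norm x) *\<^sub>R x) has_derivative
      (\<lambda>h. radial_hessian f1 f2 x *v h)) (at x)"
    by simp
qed (use x in \<open>auto simp: gradient_radial[OF f]\<close>)

lemma hessian_radial:
  fixes x :: "real^'n"
  assumes "\<And>r. 0 < r \<Longrightarrow> (f has_real_derivative f1 r) (at r)"
    and "\<And>r. 0 < r \<Longrightarrow> (f1 has_real_derivative f2 r) (at r)"
    and "x \<noteq> 0"
  shows "hessian (\<lambda>x. f (norm x)) x = radial_hessian f1 f2 x"
proof -
  have "hessian (\<lambda>x. f (norm x)) x = matrix (\<lambda>h. radial_hessian f1 f2 x *v h)"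
    unfolding hessian_def jacobian_def
    using frechet_derivative_at[OF gradient_radial_has_derivative[OF assms]] by simp
  then show ?thesis by simp
qed

lemma C2_on_radial:
  fixes S :: "(real^'n) set"
  assumes f: "\<And>r. 0 < r \<Longrightarrow> (f has_real_derivative f1 r) (at r)"
    and f1: "\<And>r. 0 < r \<Longrightarrow> (f1 has_real_derivative f2 r) (at r)"
    and f2: "continuous_on {0<..} f2"
    and S: "0 \<notin> S"
  shows "C2_on S (\<lambda>x. f (norm x))"
proof -
  have cont: "continuous_on {0<..} f1"
    by (intro continuous_at_imp_continuous_on ballI DERIV_isCont[OF f1]) auto
  \<comment> \<open>As a multiple of a fixed matrix the scalar part is visibly continuous.\<close>
  have H_alt: "radial_hessian f1 f2 = (\<lambda>x::real^'n. (f1 (norm x) / norm x) *\<^sub>R mat 1 +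
      ((f2 (norm x) - f1 (norm x) / norm x) / (norm x)\<^sup>2) *\<^sub>R (\<chi> i j. x$i * x$j))"
    by (auto simp: fun_eq_iff radial_hessian_def vec_eq_iff mat_def)
  have "continuous_on S (radial_hessian f1 f2)"
    unfolding H_alt using S
    by (intro continuous_intros continuous_on_compose2[OF cont] continuous_on_compose2[OF f2])
       auto
  moreover have "continuous_on S (hessian (\<lambda>x. f (norm x))) = continuous_on S (radial_hessian f1 f2)"
    using S by (intro continuous_on_cong refl hessian_radial[OF f f1]) auto
  moreover have "(\<lambda>x. f (norm x)) differentiable at x" if "x \<in> S" for x
    using GDERIV_radial[OF f, of x] that S unfolding gderiv_def differentiable_def by force
  moreover have "gradient (\<lambda>x. f (norm x)) differentiable at x" if "x \<in> S" for x
    using gradient_radial_has_derivative[OF f f1, of x] that S unfolding differentiable_def by blast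
  ultimately show ?thesis
    unfolding C2_on_def by blast
qed

section \<open>A strict barrier on a ball\<close>

text \<open>
  With \<open>P = r powr (- q - 2)\<close> and \<open>S = \<epsilon> * r powr (s - 2)\<close> every term is linear in \<open>P\<close> and \<open>S\<close>.
  The bound on \<open>c\<close> is the one for which the coefficient of \<open>P\<close> vanishes, and what
  remains is \<open>- m * S\<close> times
  \<open>A * s + (\<Lambda>2 * s * (s - 1) - \<gamma> * r * (s + q)) + q * (A - \<Lambda>2 * (q + 1))\<close>.
  The choice of \<open>s\<close> makes the bracket nonnegative, and the last term is positive by
  \<open>E\<close>. The two smallness conditions on \<open>\<epsilon>\<close> keep \<open>\<phi>\<close> nonpositive, so that the upper bound on \<open>c\<close>
  becomes a lower bound on \<open>c * \<phi>\<close>, and keep the radial eigenvalue nonpositive, so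
  that it is weighted by \<open>\<Lambda>2\<close>.
\<close>
lemma barrier_strict_inequality:
  fixes x :: "real^'n"
  assumes pos: "0 < \<Lambda>1" "0 < \<Lambda>2" "0 \<le> \<gamma>" "0 < q" "x \<noteq> 0" "norm x \<le> \<rho>"
    and E: "\<Lambda>2 * (q + 1) < \<Lambda>1 * (real CARD('n) - 1)"
    and c: "c \<le> - q * (\<Lambda>2 * (q + 1) - \<Lambda>1 * (real CARD('n) - 1)) / (norm x)\<^sup>2 - \<gamma> * q / norm x"
    and s: "1 + q + 2 * \<gamma> * \<rho> / \<Lambda>2 \<le> s"
    and \<epsilon>: "0 < \<epsilon>" "\<epsilon> * norm x powr (s + q) \<le> 1"
      "\<epsilon> * norm x powr (s + q) * (s * (s - 1)) \<le> q * (q + 1)"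
    and m: "m < 0"
  defines "\<phi> \<equiv> \<lambda>x::real^'n. m * (norm x powr - q - \<epsilon> * norm x powr s)"
  shows "0 < pucci_minus \<Lambda>1 \<Lambda>2 (hessian \<phi> x) - \<gamma> * norm (gradient \<phi> x) + c * \<phi> x"
    and "C2_on (- {0}) \<phi>"
proof -
  define f where "f r = m * (r powr - q - \<epsilon> * r powr s)" for r
  define f1 where "f1 r = m * (- q * r powr (- q - 1) - \<epsilon> * s * r powr (s - 1))" for r
  define f2 where "f2 r = m * (q * (q + 1) * r powr (- q - 2) - \<epsilon> * s * (s - 1) * r powr (s - 2))" for r
  have \<phi>: "\<phi> = (\<lambda>x. f (norm x))"
    by (simp add: \<phi>_def f_def)
  have df: "(f has_real_derivative f1 r) (at r)" if "0 < r" for r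
    unfolding f_def f1_def using that by (auto intro!: derivative_eq_intros)
  have df1: "(f1 has_real_derivative f2 r) (at r)" if "0 < r" for r
    unfolding f1_def f2_def using that
    by (auto intro!: derivative_eq_intros simp: algebra_simps)
  have f2: "continuous_on {0<..} f2"
    unfolding f2_def by (intro continuous_intros) auto
  show "C2_on (- {0}) \<phi>"
    unfolding \<phi> by (rule C2_on_radial[OF df df1 f2]) auto
  define r where "r = norm x"
  have r: "0 < r" "r \<le> \<rho>" using pos by (auto simp: r_def)
  define A where "A = \<Lambda>1 * (real CARD('n) - 1)"
  have A: "0 \<le> A" using pos by (simp add: A_def Suc_le_eq)
  have "0 \<le> 2 * \<gamma> * \<rho> / \<Lambda>2" using pos r by simp
  then have s1: "1 < s" "q < s" using s pos by auto
  define P where "P = r powr (- q - 2)"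
  define S where "S = \<epsilon> * r powr (s - 2)"
  have PS: "0 < P" "0 < S" using r \<epsilon> by (auto simp: P_def S_def)
  have S_P: "S = \<epsilon> * r powr (s + q) * P"
    by (simp add: S_def P_def powr_add[symmetric])
  have "S \<le> P"
    using mult_right_mono[OF \<epsilon>(2), of P] PS by (simp add: S_P r_def)
  have conc: "s * (s - 1) * S \<le> q * (q + 1) * P"
    using mult_right_mono[OF \<epsilon>(3), of P] PS by (simp add: S_P r_def mult_ac)
  have powr_r: "r powr - q = P * r\<^sup>2" "r powr (- q - 1) = P * r" "\<epsilon> * r powr s = S * r\<^sup>2"
      "\<epsilon> * r powr (s - 1) = S * r"
    using r by (simp_all add: P_def S_def powr_diff powr_minus field_simps power2_eq_square)
  have fr: "f r = m * r\<^sup>2 * (P - S)"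
    unfolding f_def powr_r by (simp add: algebra_simps)
  have f1r: "f1 r = (- m) * r * (q * P + s * S)"
    unfolding f1_def by (simp add: powr_r mult.assoc[of \<epsilon>] mult.left_commute[of \<epsilon>] algebra_simps)
  have f2r: "f2 r = m * (q * (q + 1) * P - s * (s - 1) * S)"
    unfolding f2_def by (simp add: P_def S_def algebra_simps)
  have f1_pos: "0 < f1 r / r"
    using r m PS s1 pos unfolding f1r
    by (auto intro!: mult_neg_pos add_pos_pos mult_pos_pos)
  have f2_neg: "f2 r \<le> 0"
    using m conc unfolding f2r by (auto intro!: mult_nonpos_nonneg)
  have grad: "norm (gradient \<phi> x) = f1 r"
  proof -
    have "gradient \<phi> x = (f1 r / r) *\<^sub>R x"
      unfolding \<phi> r_def by (rule gradient_radial[OF df pos(5)])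
    then have "norm (gradient \<phi> x) = \<bar>f1 r / r\<bar> * r"
      by (simp add: r_def)
    then show ?thesis
      using f1_pos r by (simp add: zero_less_divide_iff)
  qed
  have hess: "hessian \<phi> x = mat (f1 r / r) + ((f2 r - f1 r / r) / r\<^sup>2) *\<^sub>R (\<chi> i j. x$i * x$j)"
    using hessian_radial[OF df df1 pos(5)] by (simp add: \<phi> radial_hessian_def r_def)
  have radial_eigenvalue: "f1 r / r + (f2 r - f1 r / r) / r\<^sup>2 * (norm x)\<^sup>2 = f2 r"
    using r by (simp add: r_def)
  have pucci: "pucci_minus \<Lambda>1 \<Lambda>2 (hessian \<phi> x) = A * (f1 r / r) + \<Lambda>2 * f2 r"
    unfolding hess A_def
    using pucci_minus_scalar_plus_rank_one[of "f1 r / r" "(f2 r - f1 r / r) / r\<^sup>2" x, unfolded radial_eigenvalue]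
      f1_pos f2_neg by simp
  have "(- q * (\<Lambda>2 * (q + 1) - A) / r\<^sup>2 - \<gamma> * q / r) * f r \<le> c * f r"
  proof (rule mult_right_mono_neg)
    show "f r \<le> 0"
      using m \<open>S \<le> P\<close> unfolding fr by (auto intro!: mult_nonpos_nonneg)
  qed (use c in \<open>simp add: A_def r_def\<close>)
  moreover have "(- q * (\<Lambda>2 * (q + 1) - A) / r\<^sup>2 - \<gamma> * q / r) * f r =
      m * ((q * (A - \<Lambda>2 * (q + 1)) - \<gamma> * q * r) * (P - S))"
    using r unfolding fr by (simp add: field_simps power2_eq_square)
  moreover have "A * (f1 r / r) + \<Lambda>2 * f2 r - \<gamma> * f1 r + m * ((q * (A - \<Lambda>2 * (q + 1)) - \<gamma> * q * r) * (P - S))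
      = - m * S * (A * s + (\<Lambda>2 * s * (s - 1) - \<gamma> * r * (s + q)) + q * (A - \<Lambda>2 * (q + 1)))"
  proof -
    have "f1 r / r = - m * (q * P + s * S)"
      using r by (simp add: f1r)
    then show ?thesis
      by (simp only: f1r f2r) (simp add: algebra_simps)
  qed
  moreover have "\<gamma> * r * (s + q) \<le> \<Lambda>2 * s * (s - 1)"
  proof -
    \<comment> \<open>Here \<open>q\<close> is absorbed by \<open>s\<close>, which is where the factor \<open>2\<close> in the bound on \<open>s\<close> comes from.\<close>
    have "\<gamma> * r * (s + q) \<le> \<gamma> * \<rho> * (2 * s)"
      using r pos s1 by (intro mult_mono) auto
    also have "\<dots> = s * (\<Lambda>2 * (2 * \<gamma> * \<rho> / \<Lambda>2))"
      using pos by simp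
    also have "\<dots> \<le> s * (\<Lambda>2 * (s - 1))"
      using s pos s1 by (intro mult_left_mono) auto
    finally show ?thesis by (simp add: mult_ac)
  qed
  then have "0 < - m * S * (A * s + (\<Lambda>2 * s * (s - 1) - \<gamma> * r * (s + q)) + q * (A - \<Lambda>2 * (q + 1)))"
    using m PS A s1 E pos(4) unfolding A_def[symmetric]
    by (intro mult_pos_pos add_nonneg_pos add_nonneg_nonneg) auto
  ultimately show "0 < pucci_minus \<Lambda>1 \<Lambda>2 (hessian \<phi> x) - \<gamma> * norm (gradient \<phi> x) + c * \<phi> x"
    unfolding pucci grad by (simp add: \<phi> flip: r_def)
qed

section \<open>Touching from below\<close>

text \<open>The frontier cannot carry values below zero and neither can a neighbourhood of infinity
  carry values below \<open>a\<close>; what is left is bounded and stays inside \<open>\<Omega>\<close>.\<close>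
lemma compact_negative_sublevel:
  fixes w :: "'a::euclidean_space \<Rightarrow> real"
  assumes "open \<Omega>" "continuous_on (closure \<Omega>) w"
    and fr: "\<forall>x\<in>frontier \<Omega>. 0 \<le> w x"
    and lim: "0 \<le> Liminf (inf at_infinity (principal \<Omega>)) (\<lambda>x. ereal (w x))"
    and "a < 0"
  shows "compact {x \<in> closure \<Omega>. w x \<le> a}" "{x \<in> closure \<Omega>. w x \<le> a} \<subseteq> \<Omega>"
proof -
  let ?K = "{x \<in> closure \<Omega>. w x \<le> a}"
  show sub: "?K \<subseteq> \<Omega>"
  proof
    fix x assume x: "x \<in> ?K"
    then have "x \<notin> frontier \<Omega>" using fr \<open>a < 0\<close> by force
    then show "x \<in> \<Omega>" using x \<open>open \<Omega>\<close> by (simp add: frontier_def interior_open)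
  qed
  have "ereal a < 0" using \<open>a < 0\<close> by simp
  then have "\<forall>\<^sub>F x in inf at_infinity (principal \<Omega>). ereal a < ereal (w x)"
    using lim unfolding le_Liminf_iff by blast
  then obtain B where B: "\<And>x. x \<in> \<Omega> \<Longrightarrow> B \<le> norm x \<Longrightarrow> a < w x"
    by (auto simp: eventually_inf_principal eventually_at_infinity)
  have "bounded ?K"
    unfolding bounded_iff using B sub by (intro exI[of _ B]) force
  moreover have "closed ?K"
    using continuous_closed_preimage[OF assms(2) closed_closure closed_atMost[of a]]
    by (simp add: vimage_def Int_def)
  ultimately show "compact ?K" by (simp add: compact_eq_bounded_closed)
qed

theorem corollary3:
  fixes \<Lambda>1 \<Lambda>2 \<gamma> q R :: real
    and \<Omega> :: "(real^'n) set"
    and c u :: "real^'n \<Rightarrow> real"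
  assumes "0 < \<Lambda>1" and "\<Lambda>1 \<le> \<Lambda>2"
    and "0 \<le> \<gamma>"
    and "0 < q" and "q < n_star \<Lambda>1 \<Lambda>2 CARD('n) - 2"
    and "0 < R"
    and "open \<Omega>" and "connected \<Omega>" and "\<Omega> \<noteq> {}" and "\<Omega> \<subseteq> - ball 0 R"
    and "c \<in> borel_measurable (lebesgue_on \<Omega>)" and "bounded (c ` \<Omega>)"
    and "\<forall>x\<in>\<Omega>. norm x > R \<longrightarrow>
           c x \<le> - q * (\<Lambda>2 * (q + 1) - \<Lambda>1 * (real CARD('n) - 1)) / (norm x)\<^sup>2 - \<gamma> * q / norm x"
    and "continuous_on (closure \<Omega>) u"
    and "viscosity_supersolution \<Lambda>1 \<Lambda>2 \<gamma> c \<Omega> u"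
    and "\<forall>x\<in>frontier \<Omega>. 0 \<le> u x"
    and "0 \<le> Liminf (inf at_infinity (principal \<Omega>)) (\<lambda>x. ereal (u x * norm x powr q))"
  shows "\<forall>x\<in>\<Omega>. 0 \<le> u x"
proof (rule ccontr)
  assume "\<not> (\<forall>x\<in>\<Omega>. 0 \<le> u x)"
  then obtain x1 where x1: "x1 \<in> \<Omega>" "u x1 < 0" by (auto simp: not_le)
  have \<Lambda>2: "0 < \<Lambda>2" using assms(1,2) by linarith
  \<comment> \<open>The powers of \<open>norm x\<close> are regular up to the boundary, which stays away from the origin.\<close>
  have norm_closure: "R \<le> norm x" if "x \<in> closure \<Omega>" for x
  proof -
    have "closure \<Omega> \<subseteq> - ball 0 R"
      by (rule closure_minimal[OF assms(10)]) auto
    then show ?thesis using that by (auto simp: subset_iff not_less)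
  qed
  \<comment> \<open>An open set outside the open ball misses the sphere too, so the bound on \<open>c\<close> holds on all of \<open>\<Omega>\<close>.\<close>
  have norm_gt: "R < norm x" if "x \<in> \<Omega>" for x :: "real^'n"
  proof -
    have "\<Omega> \<subseteq> interior (- ball 0 R)"
      by (rule interior_maximal[OF assms(10,7)])
    then show ?thesis using that \<open>0 < R\<close> by (auto simp: interior_complement closure_ball)
  qed
  define w where "w x = u x * norm x powr q" for x
  have w_cont: "continuous_on (closure \<Omega>) w"
    unfolding w_def using assms(14) norm_closure \<open>0 < R\<close> by (intro continuous_intros) force+
  have w1: "w x1 < 0"
    using x1 norm_gt[of x1] \<open>0 < R\<close> by (auto simp: w_def intro!: mult_neg_pos)
  \<comment> \<open>Half the value at \<open>x1\<close>: the gap is the room needed to keep the minimum off the edge of \<open>K\<close>.\<close>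
  define K where "K = {x \<in> closure \<Omega>. w x \<le> w x1 / 2}"
  have "\<forall>x\<in>frontier \<Omega>. 0 \<le> w x"
    using assms(16) by (simp add: w_def)
  from compact_negative_sublevel[OF \<open>open \<Omega>\<close> w_cont this, of "w x1 / 2"]
  have K: "compact K" "K \<subseteq> \<Omega>"
    using w1 assms(17) by (simp_all add: K_def w_def)
  have "x1 \<in> K" using w1 x1 closure_subset by (auto simp: K_def)
  obtain \<rho> where \<rho>: "0 < \<rho>" "\<And>x. x \<in> K \<Longrightarrow> norm x \<le> \<rho>"
    using compact_imp_bounded[OF K(1)] by (auto simp: bounded_pos)
  define s where "s = 1 + q + 2 * \<gamma> * \<rho> / \<Lambda>2"
  have "1 < s" using assms(3,4) \<Lambda>2 \<rho>(1) by (simp add: s_def add_pos_nonneg)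
  \<comment> \<open>A bound for \<open>1 - \<psi> / v\<close> on \<open>K\<close>; the second entry keeps the radial eigenvalue of
    \<open>m * \<psi>\<close> nonpositive, the first one is a number below one half.\<close>
  define \<delta> where "\<delta> = min (1 / 4) (q * (q + 1) / (s * (s - 1)))"
  have \<delta>: "0 < \<delta>" "\<delta> \<le> 1 / 4" "\<delta> * (s * (s - 1)) \<le> q * (q + 1)"
  proof -
    have pos: "0 < s * (s - 1)" "0 < q * (q + 1)"
      using \<open>1 < s\<close> assms(4) by auto
    then show "0 < \<delta>" "\<delta> \<le> 1 / 4"
      unfolding \<delta>_def by (simp_all only: min_less_iff_conj min.cobounded1) auto
    have "\<delta> \<le> q * (q + 1) / (s * (s - 1))"
      by (simp add: \<delta>_def)
    then show "\<delta> * (s * (s - 1)) \<le> q * (q + 1)"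
      using pos by (simp add: pos_le_divide_eq)
  qed
  define \<epsilon> where "\<epsilon> = \<delta> / \<rho> powr (s + q)"
  have \<epsilon>: "0 < \<epsilon>" using \<delta> \<rho> by (simp add: \<epsilon>_def)
  have \<epsilon>_le: "\<epsilon> * norm x powr (s + q) \<le> \<delta>" if "x \<in> K" for x
  proof -
    have "norm x powr (s + q) \<le> \<rho> powr (s + q)"
      using \<rho> that \<open>1 < s\<close> \<open>0 < q\<close> by (intro powr_mono2) auto
    then have "\<epsilon> * norm x powr (s + q) \<le> \<epsilon> * \<rho> powr (s + q)"
      using \<epsilon> by (intro mult_left_mono) auto
    then show ?thesis using \<rho> by (simp add: \<epsilon>_def)
  qed
  define \<psi> where "\<psi> x = norm x powr - q - \<epsilon> * norm x powr s" for x :: "real^'n"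
  have norm_pos: "0 < norm x" if "x \<in> \<Omega>" for x
    using norm_gt[OF that] \<open>0 < R\<close> by linarith
  have \<psi>_w: "\<psi> x * norm x powr q = 1 - \<epsilon> * norm x powr (s + q)" if "x \<in> K" for x
  proof -
    have "0 < norm x" using norm_pos that K(2) by blast
    then show ?thesis
      by (simp add: \<psi>_def left_diff_distrib powr_add[symmetric] mult.assoc)
  qed
  have \<psi>_bounds: "3 / 4 \<le> \<psi> x * norm x powr q" "\<psi> x * norm x powr q \<le> 1" if "x \<in> K" for x
    using \<psi>_w[OF that] \<epsilon>_le[OF that] \<delta>(2) mult_nonneg_nonneg[OF less_imp_le[OF \<epsilon>] powr_ge_zero]
    by simp_all
  have \<psi>_pos: "0 < \<psi> x" if "x \<in> K" for x
  proof -
    have "0 < norm x" using norm_pos that K(2) by blast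
    moreover have "0 < \<psi> x * norm x powr q" using \<psi>_bounds(1)[OF that] by linarith
    ultimately show ?thesis by (simp add: zero_less_mult_iff)
  qed
  have quot: "u x / \<psi> x = w x / (\<psi> x * norm x powr q)" if "x \<in> K" for x
  proof -
    have "0 < norm x" using norm_pos that K(2) by blast
    then show ?thesis by (simp add: w_def)
  qed
  have "continuous_on K \<psi>"
  proof -
    have "\<forall>x\<in>K. norm x \<noteq> 0" using norm_pos K(2) by fastforce
    then show ?thesis
      unfolding \<psi>_def by (intro continuous_intros) auto
  qed
  moreover have "continuous_on K u"
    using assms(14) by (rule continuous_on_subset) (auto simp: K_def)
  ultimately have "continuous_on K (\<lambda>x. u x / \<psi> x)"
    using \<psi>_pos by (intro continuous_on_divide) force+
  then obtain y where y: "y \<in> K" "\<And>x. x \<in> K \<Longrightarrow> u y / \<psi> y \<le> u x / \<psi> x"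
    using continuous_attains_inf[OF K(1), of "\<lambda>x. u x / \<psi> x"] \<open>x1 \<in> K\<close> by fastforce
  define m where "m = u y / \<psi> y"
  \<comment> \<open>As \<open>\<psi> \<le> v\<close>, the negative quotient only drops when \<open>v\<close> is replaced by \<open>\<psi>\<close>.\<close>
  have "m \<le> w x1"
  proof -
    have "m \<le> w x1 / (\<psi> x1 * norm x1 powr q)"
      using y(2)[OF \<open>x1 \<in> K\<close>] quot[OF \<open>x1 \<in> K\<close>] by (simp add: m_def)
    also have "\<dots> \<le> w x1 / 1"
      using \<psi>_bounds[OF \<open>x1 \<in> K\<close>] w1 by (intro divide_left_mono_neg) auto
    finally show ?thesis by simp
  qed
  then have m: "m < 0" using w1 by simp
  \<comment> \<open>The minimum lies strictly below the level of \<open>K\<close>, since \<open>3 / 4 > 1 / 2\<close>.\<close>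
  have "w y < w x1 / 2"
  proof -
    have "w y = m * (\<psi> y * norm y powr q)"
    proof -
      have "\<psi> y * norm y powr q \<noteq> 0"
        using \<psi>_bounds(1)[OF y(1)] by linarith
      then show ?thesis
        unfolding m_def quot[OF y(1)] by (rule nonzero_eq_divide_eq[THEN iffD1, OF _ refl, symmetric])
    qed
    also have "\<dots> \<le> m * (3 / 4)"
      using \<psi>_bounds(1)[OF y(1)] m by (intro mult_left_mono_neg) auto
    finally show ?thesis using \<open>m \<le> w x1\<close> w1 by simp
  qed
  have touching: "local_min_on \<Omega> (\<lambda>x. u x - m * \<psi> x) y"
  proof -
    have "continuous_on \<Omega> w"
      using w_cont closure_subset by (rule continuous_on_subset)
    then have "open {x \<in> \<Omega>. w x < w x1 / 2}"
      using continuous_open_preimage[OF _ \<open>open \<Omega>\<close> open_lessThan[of "w x1 / 2"]]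
      by (simp add: vimage_def Int_def)
    moreover have "y \<in> {x \<in> \<Omega>. w x < w x1 / 2}"
      using \<open>w y < w x1 / 2\<close> y K by auto
    ultimately obtain e where e: "0 < e" "ball y e \<subseteq> {x \<in> \<Omega>. w x < w x1 / 2}"
      unfolding open_contains_ball by blast
    have "u y - m * \<psi> y \<le> u x - m * \<psi> x" if "x \<in> ball y e" for x
    proof -
      have "x \<in> \<Omega>" "w x < w x1 / 2"
        using that e(2) by auto
      then have "x \<in> K"
        using closure_subset[of \<Omega>] by (auto simp: K_def)
      then have "m * \<psi> x \<le> u x"
        using y(2)[of x] \<psi>_pos[of x] by (simp add: m_def pos_le_divide_eq)
      moreover have "m * \<psi> y = u y"
        using \<psi>_pos[OF y(1)] by (simp add: m_def)
      ultimately show ?thesis by simp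
    qed
    then show ?thesis
      using e(1) y(1) K(2) unfolding local_min_on_def by blast
  qed
  have supercritical: "\<Lambda>2 * (q + 1) < \<Lambda>1 * (real CARD('n) - 1)"
    using assms(5) \<Lambda>2 by (simp add: n_star_def field_simps)
  have \<epsilon>_y: "\<epsilon> * norm y powr (s + q) \<le> 1" "\<epsilon> * norm y powr (s + q) * (s * (s - 1)) \<le> q * (q + 1)"
  proof -
    have "\<epsilon> * norm y powr (s + q) * (s * (s - 1)) \<le> \<delta> * (s * (s - 1))"
      using \<epsilon>_le[OF y(1)] \<open>1 < s\<close> by (intro mult_right_mono) auto
    then show "\<epsilon> * norm y powr (s + q) * (s * (s - 1)) \<le> q * (q + 1)"
      using \<delta>(3) by linarith
  qed (use \<epsilon>_le[OF y(1)] \<delta> in linarith)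
  have y': "y \<in> \<Omega>" "y \<noteq> 0" "norm y \<le> \<rho>"
    using y(1) K(2) norm_pos[of y] \<rho>(2) by auto
  have c_y: "c y \<le> - q * (\<Lambda>2 * (q + 1) - \<Lambda>1 * (real CARD('n) - 1)) / (norm y)\<^sup>2 - \<gamma> * q / norm y"
    using assms(13) norm_gt y'(1) by blast
  have strict: "0 < pucci_minus \<Lambda>1 \<Lambda>2 (hessian (\<lambda>x. m * \<psi> x) y) -
        \<gamma> * norm (gradient (\<lambda>x. m * \<psi> x) y) + c y * (m * \<psi> y)"
    and C2: "C2_on (- {0}) (\<lambda>x::real^'n. m * \<psi> x)"
    using barrier_strict_inequality[OF assms(1) \<Lambda>2 assms(3,4) y'(2,3) supercritical c_y
        eq_refl[OF s_def[symmetric]] \<epsilon> \<epsilon>_y m]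
    by (simp_all add: \<psi>_def)
  have "C2_on \<Omega> (\<lambda>x. m * \<psi> x)"
    using C2 norm_pos unfolding C2_on_def
    by (auto intro: continuous_on_subset)
  with touching have "pucci_minus \<Lambda>1 \<Lambda>2 (hessian (\<lambda>x. m * \<psi> x) y) - \<gamma> * norm (gradient (\<lambda>x. m * \<psi> x) y)
      + c y * u y \<le> 0"
    using assms(15) y(1) K(2) unfolding viscosity_supersolution_def by blast
  moreover have "m * \<psi> y = u y"
    using \<psi>_pos[OF y(1)] by (simp add: m_def)
  ultimately show False using strict by simp
qed

end
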